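(* Let $(\mathcal{Y}_n)_{n\ge1}$ be the binary Hollywood process with parameter $(\alpha,\theta)$, where $0<\alpha<1$ and $\theta>-\alpha$. Fix any $c\ge0$. For each $n\ge1$ let $H_n^{c}$ be the graph whose vertex set is the vertex set of $\mathcal{Y}_n$ and whose edges are the ordered pairs $A$ such that $\#\{i\le n:X_i=A\}>c$. Then, almost surely, $$\limsup_{n\to\infty}\frac{e(H_n^{c})}{v(H_n^{c})^2}=0,$$ i.e. $(H_n^{c})_{n\ge1}$ is sparse almost surely.
   Context: Binary Hollywood process with parameter $(\alpha,\theta)$: generate $X_1,X_2,\dots$, each $X_n=(X_{n,1},X_{n,2})$ an ordered pair of positive integer labels, chosen sequentially as follows. Let $V_n(j)$ be the number of distinct labels among $X_1,\dots,X_{n-1},X_{n,1},\dots,X_{n,j-1}$ (labels $1,2,\dots$ assigned in order of first appearance), and for $i\le V_n(j)$ let $D_{n,j}(i)$ be the number of occurrences of label $i$ among these. Then $\mathrm{pr}(X_{n,j}=i\mid\text{past})\propto D_{n,j}(i)-\alpha$ for $i=1,\dots,V_n(j)$ and $\propto\theta+\alpha V_n(j)$ for $i=V_n(j)+1$. $\mathcal{Y}_n$ is the network with (possibly repeated, possibly loop) edges $X_1,\dots,X_n$. The graph $H_n^c$ is the $(t,c)$-projection of $\mathcal{Y}_n$ with $t$ the cardinality map: multiple occurrences of the same pair are collapsed into a single edge if they occur more than $c$ times, and discarded otherwise; $e(H_n^c)$ is its number of edges and $v(H_n^c)$ is the number of vertices of $\mathcal{Y}_n$. *)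

theory Defs
  imports "HOL-Probability.Probability"
begin

text \<open>Labels are positive integers assigned in order of first appearance.
  The sequence of labels X_{1,1}, X_{1,2}, X_{2,1}, X_{2,2}, ... is flattened into a list.
  hw_cond a t ls x is the conditional probability that the next label is x given
  the previously drawn labels ls.\<close>

definition hw_cond :: "real \<Rightarrow> real \<Rightarrow> nat list \<Rightarrow> nat \<Rightarrow> real" where
  "hw_cond a t ls x =
     (let V = card (set ls); N = length ls in
      if ls = [] then (if x = 1 then 1 else 0)
      else if 1 \<le> x \<and> x \<le> V then (real (count_list ls x) - a) / (t + real N)
      else if x = V + 1 then (t + a * real V) / (t + real N)
      else 0)"

fun hw_prob :: "real \<Rightarrow> real \<Rightarrow> nat list \<Rightarrow> real" where
  "hw_prob a t [] = 1"
| "hw_prob a t (x # xs) = hw_prob a t (butlast (x # xs)) * hw_cond a t (butlast (x # xs)) (last (x # xs))"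

definition flat_pairs :: "(nat \<times> nat) list \<Rightarrow> nat list" where
  "flat_pairs ps = concat (map (\<lambda>(u, v). [u, v]) ps)"

text \<open>The law of the binary Hollywood process: X i is the (i+1)-st edge.\<close>
definition hollywood_process ::
  "'w measure \<Rightarrow> real \<Rightarrow> real \<Rightarrow> (nat \<Rightarrow> 'w \<Rightarrow> nat \<times> nat) \<Rightarrow> bool" where
  "hollywood_process M a t X \<longleftrightarrow>
     prob_space M \<and>
     (\<forall>i. X i \<in> measurable M (count_space UNIV)) \<and>
     (\<forall>ps. measure M {w \<in> space M. \<forall>i < length ps. X i w = ps ! i}
            = hw_prob a t (flat_pairs ps))"

text \<open>Vertices of Y_n: labels appearing among X_1..X_n (here X 0 .. X (n-1)).\<close>
definition hw_vertices :: "(nat \<Rightarrow> nat \<times> nat) \<Rightarrow> nat \<Rightarrow> nat set" where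
  "hw_vertices x n = fst ` x ` {..<n} \<union> snd ` x ` {..<n}"

definition hw_edges :: "real \<Rightarrow> (nat \<Rightarrow> nat \<times> nat) \<Rightarrow> nat \<Rightarrow> (nat \<times> nat) set" where
  "hw_edges c x n = {A. real (card {i. i < n \<and> x i = A}) > c}"

end

theory Submission
  imports Defs "HOL-Library.Discrete_Functions"
begin

text \<open>
  An edge either touches a label of degree at most d, or joins two labels of degree above d, so for
  V labels the number of distinct edges is at most d V plus the square of the number of labels of
  degree above d. With N labels drawn, V is about N to the power \<open>\<alpha>\<close>, and about
  (N/d) to the power \<open>\<alpha>\<close> of them have degree above d; so d = N to the power \<open>\<alpha>/2\<close>
  gives a bound of smaller order than V squared. Small losses in the exponents are
  harmless, which makes first moments sufficient: functions of the label sequence whose conditional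
  expectation after one more draw is an explicit multiple of the present value bound the high
  degrees from above and V from below, via Markov's inequality and the Borel--Cantelli lemma along
  powers of two, and monotonicity in n fills the gaps.
\<close>

section \<open>Bernoulli-type inequalities and recursions\<close>

text \<open>By concavity, here as weighted AM-GM (Young) for the numbers 1 + x and 1 with weights
  \<open>p\<close> and \<open>1 - p\<close>.\<close>

lemma powr_le_tangent:
  fixes x p :: real
  assumes "0 \<le> p" "p \<le> 1" "x > -1"
  shows "(1 + x) powr p \<le> 1 + p * x"
  using Youngs_inequality_0[of p "1 - p" "1 + x" 1] assms by (simp add: algebra_simps)

lemma powr_nonpos_ge_tangent:
  fixes x s :: real
  assumes "s \<le> 0" "x > -1"
  shows "1 + s * x \<le> (1 + x) powr s"
proof -
  have "ln (1 + x) \<le> x"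
    using assms(2) by (rule ln_add_one_self_le_self2)
  then have "s * x \<le> s * ln (1 + x)"
    using assms(1) by (rule mult_left_mono_neg)
  also have "1 + s * ln (1 + x) \<le> exp (s * ln (1 + x))"
    by (rule exp_ge_add_one_self)
  finally show ?thesis
    using assms(2) by (simp add: powr_def)
qed

lemma two_power_powr: "real (2 ^ k) powr x = (2 powr x) ^ k"
proof -
  have "real (2 ^ k) powr x = (2 powr real k) powr x" by (simp add: powr_realpow)
  also have "\<dots> = (2 powr x) powr real k" by (simp add: powr_powr mult.commute)
  finally show ?thesis by (simp add: powr_realpow)
qed

lemma two_power_powr_tendsto_0:
  assumes "x < (0::real)"
  shows "(\<lambda>k. real (2 ^ k) powr x) \<longlonglongrightarrow> 0"
proof -
  have "filterlim (\<lambda>k. real (2 ^ k)) at_top sequentially"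
    using filterlim_realpow_sequentially_gt1[of "2::real"]
    by (intro filterlim_at_infinity_imp_filterlim_at_top) auto
  then show ?thesis using assms by (intro tendsto_neg_powr)
qed

text \<open>For n >= 2 the ratio (n + t)/n stays between the positive constants \<open>lo\<close>
  and \<open>hi\<close>. The sign of \<open>s\<close> decides which end bounds its power, and the
  sum of both powers serves either case.\<close>

lemma powr_shift_bound:
  fixes t s :: real
  assumes "2 + t > 0"
  shows "\<exists>C>0. \<forall>n\<ge>2. (real n + t) powr s \<le> C * real n powr s"
proof -
  define lo where "lo = min 1 ((2 + t) / 2)"
  define hi where "hi = 1 + \<bar>t\<bar>"
  have lo: "0 < lo" and hi: "0 < hi"
    using assms by (auto simp: lo_def hi_def)
  have "(real n + t) powr s \<le> (lo powr s + hi powr s) * real n powr s" if "n \<ge> 2" for n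
  proof -
    define y where "y = (real n + t) / real n"
    have n: "real n \<ge> 2" using that by simp
    have y: "y = 1 + t / real n" using n by (simp add: y_def field_simps)
    have tn: "\<bar>t / real n\<bar> \<le> \<bar>t\<bar>" using n by (simp add: divide_le_eq mult_le_cancel_left1)
    have "lo \<le> y"
    proof (cases "t \<ge> 0")
      case False
      then have "t / 2 \<le> t / real n" using n by (simp add: divide_simps mult_le_cancel_left)
      moreover have "lo \<le> 1 + t / 2" by (simp add: lo_def add_divide_distrib)
      ultimately show ?thesis unfolding y by linarith
    qed (use n in \<open>simp add: y lo_def\<close>)
    have "y \<le> hi" using tn unfolding y hi_def by linarith
    have "y powr s \<le> lo powr s + hi powr s"
    proof (cases "s \<ge> 0")
      case True
      then have "y powr s \<le> hi powr s"
        using \<open>lo \<le> y\<close> \<open>y \<le> hi\<close> lo by (intro powr_mono2) auto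
      then show ?thesis by (simp add: add_increasing)
    next
      case False
      then have "y powr s \<le> lo powr s"
        using \<open>lo \<le> y\<close> lo by (intro powr_mono2') auto
      then show ?thesis by (simp add: add_increasing2)
    qed
    moreover have "real n + t = y * real n" "0 < y"
      using n lo \<open>lo \<le> y\<close> by (auto simp: y_def)
    ultimately show ?thesis
      by (simp add: powr_mult mult_right_mono)
  qed
  moreover have "0 < lo powr s + hi powr s"
    using lo hi by (simp add: add_pos_pos)
  ultimately show ?thesis by blast
qed

text \<open>The factors telescope to ((n + t)/(2 + t)) to the power \<open>s\<close>. Starting at 2
  leaves room to replace a shift t > -1 by t - 1.\<close>

lemma powr_ratio_recursion:
  fixes m :: "nat \<Rightarrow> real" and t s :: real
  assumes t: "2 + t > 0" and nonneg: "\<And>n. 0 \<le> m n"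
    and step: "\<And>n. n \<ge> 2 \<Longrightarrow> m (Suc n) \<le> ((real n + 1 + t) / (real n + t)) powr s * m n"
  shows "\<exists>C>0. \<forall>n\<ge>2. m n \<le> C * real n powr s"
proof -
  have bound: "m n \<le> m 2 / (2 + t) powr s * (real n + t) powr s" if "n \<ge> 2" for n
    using that
  proof (induction n rule: dec_induct)
    case (step n)
    have pos: "real n + t > 0" "real n + 1 + t > 0" using t step(1) by auto
    have "m (Suc n) \<le> ((real n + 1 + t) / (real n + t)) powr s * m n"
      using step(1) by (rule assms(3))
    also have "\<dots> \<le> ((real n + 1 + t) / (real n + t)) powr s *
        (m 2 / (2 + t) powr s * (real n + t) powr s)"
      using step by (intro mult_left_mono) auto
    also have "\<dots> = m 2 / (2 + t) powr s * (real (Suc n) + t) powr s"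
      using pos by (simp add: powr_divide add_ac)
    finally show ?case .
  qed (use t in simp)
  obtain C where C: "C > 0" "\<And>n. n \<ge> 2 \<Longrightarrow> (real n + t) powr s \<le> C * real n powr s"
    using powr_shift_bound[OF t, of s] by blast
  \<comment> \<open>The added 1 keeps the constant positive even when \<open>m 2\<close> is
    zero.\<close>
  define K where "K = (m 2 / (2 + t) powr s + 1) * C"
  have K: "m 2 / (2 + t) powr s \<ge> 0" using nonneg by simp
  have "m n \<le> K * real n powr s" if "n \<ge> 2" for n
  proof -
    have "m n \<le> m 2 / (2 + t) powr s * (real n + t) powr s" by (rule bound[OF that])
    also have "\<dots> \<le> (m 2 / (2 + t) powr s + 1) * (C * real n powr s)"
      using K C(2)[OF that] by (intro mult_mono) auto
    finally show ?thesis by (simp add: K_def mult_ac)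
  qed
  moreover have "K > 0" using K C(1) by (auto simp: K_def intro!: mult_pos_pos add_nonneg_pos)
  ultimately show ?thesis by blast
qed

text \<open>A discrete Gronwall estimate: the product of the factors 1 + s/(n + t) has order at most
  n to the power \<open>s\<close>. Each factor is dominated by a ratio that telescopes.\<close>

lemma linear_recursion_powr_bound:
  fixes m :: "nat \<Rightarrow> real" and t s :: real
  assumes t: "t > -1" and nonneg: "\<And>n. 0 \<le> m n"
    and step: "\<And>n. n \<ge> 1 \<Longrightarrow> m (Suc n) \<le> (1 + s / (real n + t)) * m n"
  shows "\<exists>C>0. \<forall>n\<ge>2. m n \<le> C * real n powr s"
proof (cases "s \<le> 0")
  case True
  show ?thesis
  proof (rule powr_ratio_recursion[of t])
    fix n :: nat assume n: "n \<ge> 2"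
    then have pos: "real n + t > 1" using t by simp
    have "1 + s * (1 / (real n + t)) \<le> (1 + 1 / (real n + t)) powr s"
      using True pos by (intro powr_nonpos_ge_tangent) (auto intro: less_le_trans[of _ 0])
    also have "1 + 1 / (real n + t) = (real n + 1 + t) / (real n + t)"
      using pos by (simp add: field_simps)
    finally have "1 + s / (real n + t) \<le> ((real n + 1 + t) / (real n + t)) powr s" by simp
    from mult_right_mono[OF this nonneg[of n]] step[of n] n
    show "m (Suc n) \<le> ((real n + 1 + t) / (real n + t)) powr s * m n" by simp
  qed (use t nonneg in auto)
next
  case False
  show ?thesis
  \<comment> \<open>For 0 < s < 1 the forward ratio (1 + 1/y) to the power s lies below 1 + s/y. The
    tangent bound for the exponent -s at -1/y gives the backward ratio y/(y - 1) instead, which is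
    the shift t - 1.\<close>
  proof (rule powr_ratio_recursion[of "t - 1"])
    fix n :: nat assume n: "n \<ge> 2"
    then have pos: "real n + t > 1" using t by simp
    have "1 + (- s) * (- 1 / (real n + t)) \<le> (1 + (- 1 / (real n + t))) powr (- s)"
      using False pos by (intro powr_nonpos_ge_tangent) (auto simp: divide_less_eq)
    also have "1 + (- 1 / (real n + t)) = inverse ((real n + t) / (real n + t - 1))"
      using pos by (simp add: field_simps)
    also have "\<dots> powr (- s) = ((real n + t) / (real n + t - 1)) powr s"
      using pos by (subst powr_minus, subst inverse_powr) auto
    finally have "1 + s / (real n + t) \<le> ((real n + t) / (real n + t - 1)) powr s" by simp
    from mult_right_mono[OF this nonneg[of n]] step[of n] n
    show "m (Suc n) \<le> ((real n + 1 + (t - 1)) / (real n + (t - 1))) powr s * m n"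
      by (simp add: algebra_simps)
  qed (use t nonneg in auto)
qed

section \<open>Averages over label sequences\<close>

lemma hw_prob_snoc: "hw_prob a t (ls @ [x]) = hw_prob a t ls * hw_cond a t ls x"
proof (cases ls)
  case (Cons y ys)
  have "hw_prob a t (y # (ys @ [x])) = hw_prob a t (butlast (y # (ys @ [x]))) *
      hw_cond a t (butlast (y # (ys @ [x]))) (last (y # (ys @ [x])))"
    by (rule hw_prob.simps)
  then show ?thesis using Cons by simp
qed simp

text \<open>The sequences numbered in order of first appearance; all others have probability zero.
  Each of these sets is finite, so expectations become finite sums.\<close>

fun hw_support :: "nat \<Rightarrow> nat list set" where
  "hw_support 0 = {[]}"
| "hw_support (Suc n) = (\<Union>ls\<in>hw_support n. (\<lambda>x. ls @ [x]) ` {1..Suc (card (set ls))})"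

definition hw_mean :: "real \<Rightarrow> real \<Rightarrow> nat \<Rightarrow> (nat list \<Rightarrow> real) \<Rightarrow> real" where
  "hw_mean a t n F = (\<Sum>ls\<in>hw_support n. hw_prob a t ls * F ls)"

lemma finite_hw_support [simp]: "finite (hw_support n)"
  by (induction n) auto

lemma length_hw_support: "ls \<in> hw_support n \<Longrightarrow> length ls = n"
  by (induction n arbitrary: ls) auto

text \<open>A new label is always the successor of the number of labels so far. This identifies the
  range 1..V in \<open>hw_cond\<close> with the labels that have occurred.\<close>

lemma set_hw_support: "ls \<in> hw_support n \<Longrightarrow> set ls = {1..card (set ls)}"
proof (induction n arbitrary: ls)
  case (Suc n)
  then obtain ls' x where ls: "ls = ls' @ [x]" "ls' \<in> hw_support n" "x \<in> {1..Suc (card (set ls'))}"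
    by auto
  let ?V = "card (set ls')"
  have IH: "set ls' = {1..?V}" by (rule Suc.IH[OF ls(2)])
  show ?case
  proof (cases "x \<le> ?V")
    case True
    then have "x \<in> set ls'" by (subst IH) (use ls(3) in simp)
    then have "set ls = set ls'" using ls(1) by auto
    then show ?thesis by (metis IH)
  next
    case False
    then have x: "x = Suc ?V" using ls(3) by auto
    then have "x \<notin> set ls'" using IH by (metis False atLeastAtMost_iff)
    then have "card (set ls) = Suc ?V" using ls(1) by simp
    moreover have "set ls = {1..Suc ?V}" unfolding ls(1) set_append by (subst IH) (auto simp: x)
    ultimately show ?thesis by simp
  qed
qed simp

text \<open>The tower property: condition on the first \<open>n\<close> draws, then average over the
  next one.\<close>

lemma hw_mean_Suc:
  "hw_mean a t (Suc n) F =
    (\<Sum>ls\<in>hw_support n. hw_prob a t ls *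
      (\<Sum>x\<in>{1..Suc (card (set ls))}. hw_cond a t ls x * F (ls @ [x])))"
proof -
  have "hw_mean a t (Suc n) F = (\<Sum>ls\<in>hw_support n.
      \<Sum>y\<in>(\<lambda>x. ls @ [x]) ` {1..Suc (card (set ls))}. hw_prob a t y * F y)"
    unfolding hw_mean_def hw_support.simps by (rule sum.UNION_disjoint) auto
  also have "\<dots> = (\<Sum>ls\<in>hw_support n.
      \<Sum>x\<in>{1..Suc (card (set ls))}. hw_prob a t (ls @ [x]) * F (ls @ [x]))"
    by (intro sum.cong refl) (subst sum.reindex, auto simp: inj_on_def)
  finally show ?thesis
    by (simp only: hw_prob_snoc sum_distrib_left mult.assoc)
qed

lemma hw_cond_sum:
  assumes "ls \<in> hw_support n" "n \<ge> 1"
  shows "(\<Sum>x\<in>{1..Suc (card (set ls))}. hw_cond a t ls x * F x) =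
    ((\<Sum>x\<in>set ls. (real (count_list ls x) - a) * F x)
      + (t + a * real (card (set ls))) * F (Suc (card (set ls)))) / (t + real n)"
proof -
  let ?V = "card (set ls)"
  have ne: "ls \<noteq> []" and len: "length ls = n"
    using assms length_hw_support[OF assms(1)] by auto
  have V: "{1..Suc ?V} = insert (Suc ?V) {1..?V}" by auto
  have "(\<Sum>x\<in>{1..Suc ?V}. hw_cond a t ls x * F x) =
      hw_cond a t ls (Suc ?V) * F (Suc ?V) + (\<Sum>x\<in>{1..?V}. hw_cond a t ls x * F x)"
    unfolding V by (subst sum.insert) auto
  also have "(\<Sum>x\<in>{1..?V}. hw_cond a t ls x * F x) =
      (\<Sum>x\<in>{1..?V}. (real (count_list ls x) - a) * F x / (t + real n))"
    using ne len by (intro sum.cong refl) (simp add: hw_cond_def)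
  also have "hw_cond a t ls (Suc ?V) = (t + a * real ?V) / (t + real n)"
    using ne len by (simp add: hw_cond_def)
  also have "{1..?V} = set ls"
    using set_hw_support[OF assms(1)] by (rule sym)
  finally show ?thesis
    by (simp add: add_divide_distrib flip: sum_divide_distrib) (simp add: algebra_simps add_divide_distrib)
qed

lemma sum_count_minus:
  "(\<Sum>x\<in>set ls. real (count_list ls x) - a) = real (length ls) - a * real (card (set ls))"
  using sum_count_set[of ls "set ls"] by (simp add: sum_subtractf flip: of_nat_sum)

lemma count_list_ge_1: "x \<in> set ls \<Longrightarrow> count_list ls x \<ge> 1"
  by (simp add: Suc_le_eq count_list_0_iff flip: neq0_conv)

lemma card_hw_support_ge_1:
  assumes "ls \<in> hw_support n" "n \<ge> 1"
  shows "card (set ls) \<ge> 1"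
  using assms length_hw_support[OF assms(1)] by (cases ls) (auto simp: Suc_le_eq card_gt_0_iff)

lemma new_label_notin: "ls \<in> hw_support n \<Longrightarrow> Suc (card (set ls)) \<notin> set ls"
  by (subst set_hw_support) auto

section \<open>Positivity of the weights and the one-step drift criterion\<close>

locale hollywood_parameters =
  fixes a t :: real
  assumes a_pos: "0 < a" and a_less_1: "a < 1" and t_gt: "- a < t"
begin

lemma denominator_pos: "n \<ge> 1 \<Longrightarrow> 0 < t + real n"
  using a_less_1 t_gt by simp

lemma new_label_weight_pos: "V \<ge> 1 \<Longrightarrow> 0 < t + a * real V"
proof -
  assume "V \<ge> 1"
  then have "a * 1 \<le> a * real V" using a_pos by (intro mult_left_mono) auto
  then show ?thesis using t_gt by simp
qed

lemma hw_cond_nonneg: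
  assumes "ls \<in> hw_support n"
  shows "0 \<le> hw_cond a t ls x"
proof (cases "ls = []")
  case False
  have len: "length ls = n" using assms by (rule length_hw_support)
  then have n: "n \<ge> 1" using False by (cases ls) auto
  have "1 \<le> count_list ls x" if "1 \<le> x" "x \<le> card (set ls)"
  proof -
    have "x \<in> {1..card (set ls)}" using that by simp
    then have "x \<in> set ls" unfolding set_hw_support[OF assms, symmetric] .
    then show ?thesis by (rule count_list_ge_1)
  qed
  then show ?thesis
    using False denominator_pos[OF n] len a_less_1
      new_label_weight_pos[OF card_hw_support_ge_1[OF assms n]]
    by (force simp: hw_cond_def Let_def)
qed (simp add: hw_cond_def)

lemma hw_prob_nonneg: "ls \<in> hw_support n \<Longrightarrow> 0 \<le> hw_prob a t ls"
proof (induction n arbitrary: ls)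
  case (Suc n)
  then obtain ls' x where "ls = ls' @ [x]" "ls' \<in> hw_support n" by auto
  with Suc.IH show ?case by (simp add: hw_prob_snoc hw_cond_nonneg)
qed simp

lemma hw_mean_mono:
  "(\<And>ls. ls \<in> hw_support n \<Longrightarrow> F ls \<le> G ls) \<Longrightarrow> hw_mean a t n F \<le> hw_mean a t n G"
  unfolding hw_mean_def by (intro sum_mono mult_left_mono hw_prob_nonneg) auto

lemma hw_mean_nonneg:
  "(\<And>ls. ls \<in> hw_support n \<Longrightarrow> 0 \<le> F ls) \<Longrightarrow> 0 \<le> hw_mean a t n F"
  unfolding hw_mean_def by (intro sum_nonneg mult_nonneg_nonneg hw_prob_nonneg) auto

text \<open>The drift criterion used for both potentials below: the hypothesis is the conditional
  one-step bound with the common denominator t + n cleared.\<close>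

lemma hw_mean_Suc_le:
  assumes "n \<ge> 1"
    and "\<And>ls. ls \<in> hw_support n \<Longrightarrow>
      (\<Sum>x\<in>set ls. (real (count_list ls x) - a) * F (ls @ [x]))
        + (t + a * real (card (set ls))) * F (ls @ [Suc (card (set ls))]) \<le> r * (t + real n) * F ls"
  shows "hw_mean a t (Suc n) F \<le> r * hw_mean a t n F"
proof -
  have "hw_mean a t (Suc n) F \<le> hw_mean a t n (\<lambda>ls. r * F ls)"
    unfolding hw_mean_Suc unfolding hw_mean_def
  proof (intro sum_mono mult_left_mono hw_prob_nonneg)
    fix ls assume ls: "ls \<in> hw_support n"
    show "(\<Sum>x\<in>{1..Suc (card (set ls))}. hw_cond a t ls x * F (ls @ [x])) \<le> r * F ls"
      using hw_cond_sum[OF ls assms(1), of a t "\<lambda>x. F (ls @ [x])"]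
        assms(2)[OF ls] denominator_pos[OF assms(1)]
      by (simp add: divide_le_eq mult_ac)
  qed
  also have "\<dots> = r * hw_mean a t n F"
    by (simp add: hw_mean_def sum_distrib_left mult_ac)
  finally show ?thesis .
qed

text \<open>The old labels have total weight n - aV and the new label t + aV, which add up to the
  denominator t + n. The first draw is deterministic and treated apart.\<close>

lemma hw_mean_1: "hw_mean a t n (\<lambda>_. 1) = 1"
proof (induction n)
  case (Suc n)
  have "(\<Sum>x\<in>{1..Suc (card (set ls))}. hw_cond a t ls x * 1) = 1"
    if ls: "ls \<in> hw_support n" for ls
  proof (cases "n = 0")
    case False
    then have n: "n \<ge> 1" by simp
    show ?thesis
      unfolding hw_cond_sum[OF ls n]
      using denominator_pos[OF n] length_hw_support[OF ls] by (simp add: sum_count_minus)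
  qed (use ls in \<open>simp add: hw_cond_def\<close>)
  then have "hw_mean a t (Suc n) (\<lambda>_. 1) = hw_mean a t n (\<lambda>_. 1)"
    unfolding hw_mean_Suc unfolding hw_mean_def by (intro sum.cong) auto
  then show ?case using Suc.IH by simp
qed (simp add: hw_mean_def)


section \<open>Few labels of high degree\<close>

text \<open>Up to a constant this is Gamma(n - a + p)/Gamma(n - a), of order n to the power
  \<open>p\<close>. Going from degree j to j + 1 adds p/(j - a) times the present value, so the
  selection weight j - a cancels in conditional expectations.\<close>

definition degree_weight :: "real \<Rightarrow> nat \<Rightarrow> real" where
  "degree_weight p n = (\<Prod>j=1..<n. 1 + p / (real j - a))"

definition degree_sum :: "real \<Rightarrow> nat list \<Rightarrow> real" where
  "degree_sum p ls = (\<Sum>i\<in>set ls. degree_weight p (count_list ls i))"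

lemma degree_weight_1 [simp]: "degree_weight p (Suc 0) = 1"
  by (simp add: degree_weight_def)

lemma degree_weight_Suc:
  "n \<ge> 1 \<Longrightarrow> degree_weight p (Suc n) = degree_weight p n * (1 + p / (real n - a))"
  by (simp add: degree_weight_def prod.atLeastLessThan_Suc)

text \<open>Factor by factor: (1 + 1/j) to the power p is at most 1 + p/j, which is at most 1 + p/(j
  - a).\<close>

lemma degree_weight_ge:
  assumes "0 \<le> p" "p \<le> 1" "n \<ge> 1"
  shows "real n powr p \<le> degree_weight p n"
  using assms(3)
proof (induction n rule: dec_induct)
  case (step n)
  have n: "real n \<ge> 1" using step(1) by simp
  have "real (Suc n) = real n * (1 + 1 / real n)" using n by (simp add: field_simps)
  then have "real (Suc n) powr p = real n powr p * (1 + 1 / real n) powr p"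
    using n by (simp only: powr_mult)
  also have "\<dots> \<le> degree_weight p n * (1 + p * (1 / real n))"
  proof (intro mult_mono step.IH powr_le_tangent)
    show "0 \<le> degree_weight p n" using step.IH powr_ge_zero order_trans by blast
  qed (use assms n in \<open>auto intro: less_le_trans[of _ 0]\<close>)
  also have "\<dots> \<le> degree_weight p n * (1 + p / (real n - a))"
  proof (intro mult_left_mono add_left_mono)
    show "p * (1 / real n) \<le> p / (real n - a)"
      using n a_pos a_less_1 assms by (simp add: divide_left_mono)
    show "0 \<le> degree_weight p n" using step.IH powr_ge_zero order_trans by blast
  qed
  also have "\<dots> = degree_weight p (Suc n)" using step(1) by (simp add: degree_weight_Suc)
  finally show ?case .
qed simp

lemma degree_weight_ge_1:
  assumes "0 \<le> p" "p \<le> 1" "n \<ge> 1"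
  shows "1 \<le> degree_weight p n"
proof -
  have "1 \<le> real n powr p" using assms by (simp add: ge_one_powr_ge_zero)
  also have "\<dots> \<le> degree_weight p n" using assms by (rule degree_weight_ge)
  finally show ?thesis .
qed

lemma card_le_degree_sum:
  assumes "0 \<le> p" "p \<le> 1"
  shows "real (card (set ls)) \<le> degree_sum p ls"
proof -
  have "(\<Sum>i\<in>set ls. 1) \<le> degree_sum p ls"
    unfolding degree_sum_def
    by (intro sum_mono degree_weight_ge_1 count_list_ge_1 assms)
  then show ?thesis by simp
qed

text \<open>Markov's inequality for counting measure on the labels: each label of degree above
  \<open>d\<close> contributes at least d to the power \<open>p\<close>.\<close>

lemma high_degree_card_le:
  assumes p: "0 \<le> p" "p \<le> 1" and d: "d \<ge> 0"
  shows "real (card {i\<in>set ls. real (count_list ls i) > d}) * d powr p \<le> degree_sum p ls"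
proof -
  let ?B = "{i\<in>set ls. real (count_list ls i) > d}"
  have "real (card ?B) * d powr p = (\<Sum>i\<in>?B. d powr p)" by simp
  also have "\<dots> \<le> (\<Sum>i\<in>?B. degree_weight p (count_list ls i))"
  proof (rule sum_mono)
    fix i assume i: "i \<in> ?B"
    then have "d powr p \<le> real (count_list ls i) powr p"
      using p d by (intro powr_mono2) auto
    also have "\<dots> \<le> degree_weight p (count_list ls i)"
      using p i by (intro degree_weight_ge count_list_ge_1) auto
    finally show "d powr p \<le> degree_weight p (count_list ls i)" .
  qed
  also have "\<dots> \<le> degree_sum p ls"
    unfolding degree_sum_def
  proof (intro sum_mono2)
    fix i assume "i \<in> set ls - ?B"
    then have "1 \<le> degree_weight p (count_list ls i)"
      by (intro degree_weight_ge_1 count_list_ge_1 p) auto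
    then show "0 \<le> degree_weight p (count_list ls i)" by simp
  qed auto
  finally show ?thesis .
qed

lemma degree_sum_snoc_old:
  assumes "x \<in> set ls"
  shows "degree_sum p (ls @ [x]) =
    degree_sum p ls + p * degree_weight p (count_list ls x) / (real (count_list ls x) - a)"
proof -
  have "degree_sum p (ls @ [x]) =
      degree_weight p (count_list (ls @ [x]) x) +
      (\<Sum>i\<in>set ls - {x}. degree_weight p (count_list (ls @ [x]) i))"
    unfolding degree_sum_def using assms by (simp add: insert_absorb sum.remove[of _ x])
  also have "(\<Sum>i\<in>set ls - {x}. degree_weight p (count_list (ls @ [x]) i)) =
      (\<Sum>i\<in>set ls - {x}. degree_weight p (count_list ls i))"
    by (intro sum.cong) auto
  also have "\<dots> = degree_sum p ls - degree_weight p (count_list ls x)"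
    unfolding degree_sum_def using assms by (simp add: sum.remove[of _ x])
  also have "count_list (ls @ [x]) x = Suc (count_list ls x)" by simp
  finally show ?thesis
    using count_list_ge_1[OF assms] by (simp add: degree_weight_Suc algebra_simps)
qed

lemma degree_sum_snoc_new:
  assumes "x \<notin> set ls"
  shows "degree_sum p (ls @ [x]) = degree_sum p ls + 1"
proof -
  have "degree_sum p (ls @ [x]) =
      degree_weight p (count_list (ls @ [x]) x) +
      (\<Sum>i\<in>set ls. degree_weight p (count_list (ls @ [x]) i))"
    unfolding degree_sum_def using assms by simp
  also have "(\<Sum>i\<in>set ls. degree_weight p (count_list (ls @ [x]) i)) = degree_sum p ls"
    unfolding degree_sum_def using assms by (intro sum.cong) auto
  finally show ?thesis using assms by (simp add: count_list_0_iff)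
qed

text \<open>The multiple of the number of labels absorbs the contribution of new labels to the drift,
  which makes the conditional expectation exactly proportional to the present value.\<close>

definition degree_potential :: "real \<Rightarrow> nat list \<Rightarrow> real" where
  "degree_potential p ls = degree_sum p ls + a / (p - a) * (real (card (set ls)) + t / a)"

text \<open>In the drift, old labels contribute \<open>p * degree_sum p ls\<close> because the
  selection weights cancel, and a new label contributes 1 + k with weight t + aV. Together this is
  \<open>p\<close> times the potential.\<close>

lemma hw_mean_degree_potential_Suc:
  assumes p: "a < p" and n: "n \<ge> 1"
  shows "hw_mean a t (Suc n) (degree_potential p)
    \<le> (1 + p / (real n + t)) * hw_mean a t n (degree_potential p)"
proof (rule hw_mean_Suc_le[OF n])
  fix ls assume ls: "ls \<in> hw_support n"
  define V where "V = card (set ls)"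
  define U where "U = degree_potential p ls"
  define k where "k = a / (p - a)"
  have "(real (count_list ls x) - a) * degree_potential p (ls @ [x]) =
      (real (count_list ls x) - a) * U + p * degree_weight p (count_list ls x)"
    if x: "x \<in> set ls" for x
  proof -
    have "real (count_list ls x) - a \<noteq> 0" using count_list_ge_1[OF x] a_less_1 by auto
    moreover have "degree_potential p (ls @ [x]) =
        U + p * degree_weight p (count_list ls x) / (real (count_list ls x) - a)"
      using x by (simp add: U_def degree_potential_def degree_sum_snoc_old insert_absorb)
    ultimately show ?thesis by (simp add: distrib_left)
  qed
  then have "(\<Sum>x\<in>set ls. (real (count_list ls x) - a) * degree_potential p (ls @ [x])) =
      (\<Sum>x\<in>set ls. real (count_list ls x) - a) * U + p * degree_sum p ls"
    by (simp add: sum.distrib sum_distrib_right sum_distrib_left degree_sum_def)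
  also have "(\<Sum>x\<in>set ls. real (count_list ls x) - a) = real n - a * real V"
    using length_hw_support[OF ls] by (simp add: sum_count_minus V_def)
  finally have old: "(\<Sum>x\<in>set ls. (real (count_list ls x) - a) * degree_potential p (ls @ [x])) =
      (real n - a * real V) * U + p * degree_sum p ls" .
  have new: "degree_potential p (ls @ [Suc V]) = U + 1 + k"
    using new_label_notin[OF ls]
    by (simp add: U_def V_def k_def degree_potential_def degree_sum_snoc_new algebra_simps)
  \<comment> \<open>This equation determines k = a/(p - a): it turns \<open>p\<close> times the
    correction term into the contribution of new labels.\<close>
  have k: "p * k = a * (1 + k)" using p by (simp add: k_def field_simps)
  have "p * U = p * degree_sum p ls + (p * k) * (real V + t / a)"
    by (simp add: U_def V_def k_def degree_potential_def algebra_simps)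
  also have "\<dots> = p * degree_sum p ls + (1 + k) * (a * (real V + t / a))"
    unfolding k by simp
  also have "a * (real V + t / a) = t + a * real V" using a_pos by (simp add: field_simps)
  finally have pU: "p * U = p * degree_sum p ls + (1 + k) * (t + a * real V)" .
  have "(1 + p / (real n + t)) * (t + real n) * U = (t + real n) * U + p * U"
    using denominator_pos[OF n] by (simp add: field_simps)
  also have "\<dots> = (real n - a * real V) * U + p * degree_sum p ls + (t + a * real V) * (U + 1 + k)"
    unfolding pU by (simp add: algebra_simps)
  finally show "(\<Sum>x\<in>set ls. (real (count_list ls x) - a) * degree_potential p (ls @ [x]))
        + (t + a * real (card (set ls))) * degree_potential p (ls @ [Suc (card (set ls))])
      \<le> (1 + p / (real n + t)) * (t + real n) * degree_potential p ls"
    by (simp add: old new flip: V_def U_def)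
qed

text \<open>Once a label exists, the correction is a positive multiple of V + t/a = (t + aV)/a >
  0.\<close>

lemma degree_sum_le_potential:
  assumes "a < p" "ls \<in> hw_support n" "n \<ge> 1"
  shows "degree_sum p ls \<le> degree_potential p ls"
proof -
  have "0 < (t + a * real (card (set ls))) / a"
    using new_label_weight_pos[OF card_hw_support_ge_1[OF assms(2,3)]] a_pos by simp
  also have "\<dots> = real (card (set ls)) + t / a" using a_pos by (simp add: field_simps)
  finally have "0 \<le> real (card (set ls)) + t / a" by simp
  then show ?thesis using assms(1) a_pos by (simp add: degree_potential_def)
qed

lemma hw_mean_degree_sum_bound:
  assumes p: "a < p" "p \<le> 1"
  shows "\<exists>C>0. \<forall>n\<ge>2. hw_mean a t n (degree_sum p) \<le> C * real n powr p"
proof -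
  \<comment> \<open>At n = 0 the potential equals t/(p - a), which is negative for t < 0, whereas
    the recursion lemma asks for a nonnegative sequence; hence the value 0 there.\<close>
  define m where "m n = (if n \<ge> 1 then hw_mean a t n (degree_potential p) else 0)" for n
  have le: "degree_sum p ls \<le> degree_potential p ls" if "ls \<in> hw_support n" "n \<ge> 1" for ls n
    using degree_sum_le_potential[OF p(1) that] .
  have nonneg: "0 \<le> degree_sum p ls" for ls
    using card_le_degree_sum[of p ls] p a_pos by auto
  have "\<exists>C>0. \<forall>n\<ge>2. m n \<le> C * real n powr p"
  proof (rule linear_recursion_powr_bound)
    show "t > -1" using t_gt a_less_1 by simp
    show "0 \<le> m n" for n
      unfolding m_def using order_trans[OF nonneg le] by (auto intro!: hw_mean_nonneg)
    show "m (Suc n) \<le> (1 + p / (real n + t)) * m n" if "n \<ge> 1" for n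
      using hw_mean_degree_potential_Suc[OF p(1) that] that by (simp add: m_def)
  qed
  then obtain C where C: "C > 0" "\<And>n. n \<ge> 2 \<Longrightarrow> m n \<le> C * real n powr p" by blast
  have "hw_mean a t n (degree_sum p) \<le> C * real n powr p" if "n \<ge> 2" for n
  proof -
    have "hw_mean a t n (degree_sum p) \<le> hw_mean a t n (degree_potential p)"
      using le that by (intro hw_mean_mono) auto
    also have "\<dots> \<le> C * real n powr p" using C(2)[OF that] that by (simp add: m_def)
    finally show ?thesis .
  qed
  with C(1) show ?thesis by blast
qed

section \<open>Many labels\<close>

text \<open>Up to a constant this is Gamma(V + t/a - q)/Gamma(V + t/a), of order V to the power -q.
  The denominators are chosen to cancel the weight t + aV = a(V + t/a) of a new label. Smallness of
  this decreasing function forces many labels.\<close>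

definition label_weight :: "real \<Rightarrow> nat \<Rightarrow> real" where
  "label_weight q V = (\<Prod>j=1..<V. 1 - q / (real j + t / a))"

lemma label_weight_Suc:
  "V \<ge> 1 \<Longrightarrow> label_weight q (Suc V) = label_weight q V * (1 - q / (real V + t / a))"
  by (simp add: label_weight_def prod.atLeastLessThan_Suc)

lemma shifted_label_pos: "V \<ge> 1 \<Longrightarrow> 0 < real V + t / a"
  using new_label_weight_pos[of V] a_pos by (simp add: field_simps)

text \<open>The condition on \<open>q\<close> makes the smallest factor, at j = 1, positive.\<close>

lemma label_weight_pos:
  assumes "0 < q" "q < 1 + t / a"
  shows "0 < label_weight q V"
  unfolding label_weight_def
proof (rule prod_pos)
  fix j assume "j \<in> {1..<V}"
  then have "q < real j + t / a" "0 < real j + t / a"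
    using assms shifted_label_pos[of j] by auto
  then show "0 < 1 - q / (real j + t / a)" by simp
qed

text \<open>Each factor 1 - q/(V + b) is at least ((V - 1 + b)/(V + b)) to the power
  \<open>q\<close> by concavity, and these ratios telescope. The induction starts at V = 2 because
  at V = 1 the base V - 1 + b = b may be negative.\<close>

lemma label_weight_lower:
  assumes q: "0 < q" "q \<le> 1" "q < 1 + t / a"
  shows "\<exists>c>0. \<forall>V\<ge>1. c * real V powr (- q) \<le> label_weight q V"
proof -
  define b where "b = t / a"
  have b: "1 + b > 0" using q b_def by simp
  define K where "K = label_weight q 2 * (1 + b) powr q"
  have K: "K > 0" using label_weight_pos[OF q(1,3), of 2] b by (simp add: K_def)
  have *: "K \<le> label_weight q V * (real V - 1 + b) powr q" if "V \<ge> 2" for V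
    using that
  proof (induction V rule: dec_induct)
    case (step V)
    define x where "x = 1 / (real V + b)"
    have pos: "real V + b > 1" using step(1) b by simp
    have "(1 + (- x)) powr q \<le> 1 + q * (- x)"
      using q pos by (intro powr_le_tangent) (auto simp: x_def divide_less_eq)
    moreover have "1 + (- x) = (real V - 1 + b) / (real V + b)"
      using pos by (simp add: x_def field_simps)
    ultimately have "((real V - 1 + b) / (real V + b)) powr q \<le> 1 - q * x" by simp
    then have "(real V - 1 + b) powr q \<le> (1 - q * x) * (real V + b) powr q"
      using pos by (simp add: powr_divide divide_le_eq)
    then have "label_weight q V * (real V - 1 + b) powr q
        \<le> label_weight q V * ((1 - q * x) * (real V + b) powr q)"
      using label_weight_pos[OF q(1,3), of V] by (intro mult_left_mono) auto
    with step show ?case by (simp add: label_weight_Suc x_def b_def mult_ac)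
  qed (simp add: K_def)
  \<comment> \<open>The minimum with 1 covers V = 1, where the weight is the empty product.\<close>
  define c where "c = min 1 (K * (1 + \<bar>b\<bar>) powr (- q))"
  have "c * real V powr (- q) \<le> label_weight q V" if "V \<ge> 1" for V
  proof (cases "V = 1")
    case True
    then show ?thesis by (simp add: c_def label_weight_def)
  next
    case False
    then have V: "V \<ge> 2" using that by simp
    then have pos: "real V - 1 + b > 0" using b by simp
    have "\<bar>b\<bar> * 1 \<le> \<bar>b\<bar> * real V" using V by (intro mult_left_mono) auto
    then have le: "real V - 1 + b \<le> (1 + \<bar>b\<bar>) * real V" by (simp add: algebra_simps)
    have "c * real V powr (- q) \<le> K * (1 + \<bar>b\<bar>) powr (- q) * real V powr (- q)"
      by (intro mult_right_mono) (auto simp: c_def)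
    also have "\<dots> = K * ((1 + \<bar>b\<bar>) * real V) powr (- q)" by (simp add: powr_mult)
    also have "\<dots> \<le> K * (real V - 1 + b) powr (- q)"
      using K q pos le by (intro mult_left_mono powr_mono2') auto
    also have "\<dots> \<le> label_weight q V"
      using *[OF V] pos by (simp add: powr_minus field_simps)
    finally show ?thesis .
  qed
  moreover have "c > 0" using K by (auto simp: c_def)
  ultimately show ?thesis by blast
qed

text \<open>Only a new label changes the weight; after cancellation the drift is exactly -qa times
  the present value.\<close>

lemma hw_mean_label_weight_Suc:
  assumes n: "n \<ge> 1"
  shows "hw_mean a t (Suc n) (\<lambda>ls. label_weight q (card (set ls)))
    \<le> (1 + (- (q * a)) / (real n + t)) * hw_mean a t n (\<lambda>ls. label_weight q (card (set ls)))"
proof (rule hw_mean_Suc_le[OF n])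
  fix ls assume ls: "ls \<in> hw_support n"
  define V where "V = card (set ls)"
  have V: "V \<ge> 1" unfolding V_def using card_hw_support_ge_1[OF ls n] .
  have "(\<Sum>x\<in>set ls. (real (count_list ls x) - a) * label_weight q (card (set (ls @ [x])))) =
      (\<Sum>x\<in>set ls. real (count_list ls x) - a) * label_weight q V"
    unfolding sum_distrib_right by (intro sum.cong) (auto simp: insert_absorb V_def)
  also have "(\<Sum>x\<in>set ls. real (count_list ls x) - a) = real n - a * real V"
    using length_hw_support[OF ls] by (simp add: sum_count_minus V_def)
  finally have old: "(\<Sum>x\<in>set ls. (real (count_list ls x) - a) *
      label_weight q (card (set (ls @ [x])))) = (real n - a * real V) * label_weight q V" .
  have "card (set (ls @ [Suc V])) = Suc V"
    using new_label_notin[OF ls] by (simp add: V_def)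
  then have new: "(t + a * real V) * label_weight q (card (set (ls @ [Suc V]))) =
      (t + a * real V) * (1 - q / (real V + t / a)) * label_weight q V"
    using V by (simp add: label_weight_Suc)
  have ta: "t + a * real V = a * (real V + t / a)" using a_pos by (simp add: field_simps)
  have "(t + a * real V) * (1 - q / (real V + t / a)) = t + a * real V - q * a"
    unfolding ta using shifted_label_pos[OF V] by (simp add: right_diff_distrib)
  then have "(real n - a * real V) * label_weight q V
      + (t + a * real V) * (1 - q / (real V + t / a)) * label_weight q V
      = (t + real n - q * a) * label_weight q V"
    by (simp add: algebra_simps)
  also have "t + real n - q * a = (1 + (- (q * a)) / (real n + t)) * (t + real n)"
    using denominator_pos[OF n] by (simp add: field_simps)
  finally show "(\<Sum>x\<in>set ls. (real (count_list ls x) - a) * label_weight q (card (set (ls @ [x]))))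
        + (t + a * real (card (set ls))) * label_weight q (card (set (ls @ [Suc (card (set ls))])))
      \<le> (1 + (- (q * a)) / (real n + t)) * (t + real n) * label_weight q (card (set ls))"
    unfolding V_def[symmetric] old new by simp
qed

lemma hw_mean_label_weight_bound:
  assumes q: "0 < q" "q < 1 + t / a"
  shows "\<exists>C>0. \<forall>n\<ge>2. hw_mean a t n (\<lambda>ls. label_weight q (card (set ls))) \<le> C * real n powr (- (q * a))"
proof (rule linear_recursion_powr_bound)
  show "t > -1" using t_gt a_less_1 by simp
  show "0 \<le> hw_mean a t n (\<lambda>ls. label_weight q (card (set ls)))" for n
    using label_weight_pos[OF q] by (intro hw_mean_nonneg) (simp add: less_imp_le)
qed (rule hw_mean_label_weight_Suc)

end

section \<open>Label sequences and edges\<close>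

lemma flat_pairs_Nil [simp]: "flat_pairs [] = []"
  by (simp add: flat_pairs_def)

lemma flat_pairs_Cons [simp]: "flat_pairs ((u, v) # ps) = u # v # flat_pairs ps"
  by (simp add: flat_pairs_def)

lemma set_flat_pairs: "set (flat_pairs ps) = fst ` set ps \<union> snd ` set ps"
  by (induction ps) force+

lemma flat_pairs_inject: "flat_pairs ps = flat_pairs qs \<longleftrightarrow> ps = qs"
  by (induction ps qs rule: list_induct2') auto

lemma flat_pairs_surj: "length ls = 2 * n \<Longrightarrow> \<exists>ps. length ps = n \<and> flat_pairs ps = ls"
proof (induction n arbitrary: ls)
  case (Suc n)
  then obtain u v ls' where ls: "ls = u # v # ls'" "length ls' = 2 * n"
    by (auto simp: length_Suc_conv)
  with Suc.IH obtain ps where "length ps = n" "flat_pairs ps = ls'" by blast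
  then show ?case using ls by (intro exI[of _ "(u, v) # ps"]) auto
qed simp

text \<open>Each distinct edge at \<open>i\<close> uses up at least one occurrence of
  \<open>i\<close> in the flattened list; a loop uses two.\<close>

lemma card_incident_le: "card {A\<in>set ps. fst A = i \<or> snd A = i} \<le> count_list (flat_pairs ps) i"
proof (induction ps)
  case (Cons A ps)
  obtain u v where A: "A = (u, v)" by fastforce
  show ?case
  proof (cases "u = i \<or> v = i")
    case True
    then have "{B\<in>set (A # ps). fst B = i \<or> snd B = i} =
        insert A {B\<in>set ps. fst B = i \<or> snd B = i}" using A by auto
    then have "card {B\<in>set (A # ps). fst B = i \<or> snd B = i}
        \<le> Suc (card {B\<in>set ps. fst B = i \<or> snd B = i})"
      by (simp add: card_insert_if)
    then show ?thesis using Cons.IH True A by auto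
  next
    case False
    then have "{B\<in>set (A # ps). fst B = i \<or> snd B = i} = {B\<in>set ps. fst B = i \<or> snd B = i}"
      using A by auto
    then show ?thesis using Cons.IH False A by auto
  qed
qed simp

lemma card_edges_le:
  fixes d :: real and ps :: "(nat \<times> nat) list"
  assumes "d \<ge> 0"
  defines "ls \<equiv> flat_pairs ps"
  shows "real (card (set ps)) \<le> d * real (card (set ls))
    + real (card {i\<in>set ls. real (count_list ls i) > d}) ^ 2"
proof -
  define B where "B = {i\<in>set ls. real (count_list ls i) > d}"
  define I where "I i = {A\<in>set ps. fst A = i \<or> snd A = i}" for i
  have fin: "finite B" "finite (I i)" for i by (auto simp: B_def I_def)
  have "set ps \<subseteq> (\<Union>i\<in>set ls - B. I i) \<union> B \<times> B"
  proof
    fix A assume A: "A \<in> set ps"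
    then have "fst A \<in> set ls" "snd A \<in> set ls" by (auto simp: ls_def set_flat_pairs)
    then show "A \<in> (\<Union>i\<in>set ls - B. I i) \<union> B \<times> B"
      using A by (cases A) (auto simp: I_def)
  qed
  then have "card (set ps) \<le> card ((\<Union>i\<in>set ls - B. I i) \<union> B \<times> B)"
    using fin by (intro card_mono) auto
  also have "\<dots> \<le> card (\<Union>i\<in>set ls - B. I i) + card (B \<times> B)" by (rule card_Un_le)
  also have "\<dots> \<le> (\<Sum>i\<in>set ls - B. card (I i)) + card B ^ 2"
    using card_UN_le[of "set ls - B" I] by (simp add: card_cartesian_product power2_eq_square)
  finally have "real (card (set ps)) \<le> (\<Sum>i\<in>set ls - B. real (card (I i))) + real (card B) ^ 2"
    by (simp flip: of_nat_sum of_nat_power of_nat_add)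
  also have "(\<Sum>i\<in>set ls - B. real (card (I i))) \<le> (\<Sum>i\<in>set ls - B. d)"
  proof (rule sum_mono)
    fix i assume "i \<in> set ls - B"
    then have "real (count_list ls i) \<le> d" by (auto simp: B_def)
    moreover have "card (I i) \<le> count_list ls i"
      unfolding I_def ls_def by (rule card_incident_le)
    ultimately show "real (card (I i)) \<le> d" by linarith
  qed
  also have "\<dots> \<le> d * real (card (set ls))"
    using assms(1) by (simp add: mult.commute mult_left_mono card_mono)
  finally show ?thesis by (simp add: B_def)
qed

lemma hw_vertices_eq: "hw_vertices x n = set (flat_pairs (map x [0..<n]))"
  by (simp add: hw_vertices_def set_flat_pairs atLeast0LessThan)

text \<open>More than c >= 0 occurrences means at least one. Bounding the number of distinct pairs
  drawn thus settles every threshold \<open>c\<close> at once.\<close>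

lemma hw_edges_subset:
  assumes "c \<ge> 0"
  shows "hw_edges c x n \<subseteq> set (map x [0..<n])"
proof
  fix A assume "A \<in> hw_edges c x n"
  then have "card {i. i < n \<and> x i = A} \<noteq> 0"
    using assms by (intro notI) (simp add: hw_edges_def del: card_0_eq card_eq_0_iff)
  then have "{i. i < n \<and> x i = A} \<noteq> {}" by force
  then show "A \<in> set (map x [0..<n])" by auto
qed

section \<open>Tail bounds along powers of two\<close>

text \<open>Lists of pairs of naturals form a countable type, so measurable preimages of singletons
  suffice.\<close>

lemma hollywood_list_measurable:
  assumes "hollywood_process M a t X"
  shows "(\<lambda>w. map (\<lambda>i. X i w) [0..<n]) \<in> measurable M (count_space UNIV)"
proof -
  have [measurable]: "X i \<in> measurable M (count_space UNIV)" for i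
    using assms by (auto simp: hollywood_process_def)
  have "(\<lambda>w. map (\<lambda>i. X i w) [0..<n]) -` {ps} \<inter> space M \<in> sets M" for ps
  proof -
    have "(\<lambda>w. map (\<lambda>i. X i w) [0..<n]) -` {ps} \<inter> space M =
        (if length ps = n then {w\<in>space M. \<forall>i\<in>{..<n}. X i w = ps ! i} else {})"
      unfolding vimage_def singleton_iff list_eq_iff_nth_eq by auto
    also have "\<dots> \<in> sets M" by simp
    finally show ?thesis .
  qed
  then show ?thesis by (simp add: measurable_count_space_eq2_countable)
qed

lemma hollywood_flat_pairs_sets:
  assumes "hollywood_process M a t X"
  shows "{w\<in>space M. P (flat_pairs (map (\<lambda>i. X i w) [0..<n]))} \<in> sets M"
proof -
  have "(\<lambda>w. map (\<lambda>i. X i w) [0..<n]) -` {ps. P (flat_pairs ps)} \<inter> space M \<in> sets M"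
    using hollywood_list_measurable[OF assms] by (rule measurable_sets) simp
  also have "(\<lambda>w. map (\<lambda>i. X i w) [0..<n]) -` {ps. P (flat_pairs ps)} \<inter> space M =
      {w\<in>space M. P (flat_pairs (map (\<lambda>i. X i w) [0..<n]))}" by auto
  finally show ?thesis .
qed

lemma hollywood_measure_eq:
  assumes X: "hollywood_process M a t X" and len: "length ls = 2 * n"
  shows "measure M {w\<in>space M. flat_pairs (map (\<lambda>i. X i w) [0..<n]) = ls} = hw_prob a t ls"
proof -
  obtain ps where ps: "length ps = n" "flat_pairs ps = ls"
    using flat_pairs_surj[OF len] by blast
  have "{w\<in>space M. flat_pairs (map (\<lambda>i. X i w) [0..<n]) = ls} =
      {w\<in>space M. \<forall>i<length ps. X i w = ps ! i}"
    unfolding ps(2)[symmetric] flat_pairs_inject using ps(1) by (auto simp: list_eq_iff_nth_eq)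
  then show ?thesis using X ps(2) by (simp add: hollywood_process_def)
qed

lemma hollywood_measure_mem:
  assumes X: "hollywood_process M a t X" and Q: "Q \<subseteq> hw_support (2 * n)"
  shows "measure M {w\<in>space M. flat_pairs (map (\<lambda>i. X i w) [0..<n]) \<in> Q} = (\<Sum>ls\<in>Q. hw_prob a t ls)"
proof -
  interpret prob_space M using X by (simp add: hollywood_process_def)
  let ?A = "\<lambda>ls. {w\<in>space M. flat_pairs (map (\<lambda>i. X i w) [0..<n]) = ls}"
  have "{w\<in>space M. flat_pairs (map (\<lambda>i. X i w) [0..<n]) \<in> Q} = (\<Union>ls\<in>Q. ?A ls)" by auto
  also have "measure M \<dots> = (\<Sum>ls\<in>Q. measure M (?A ls))"
    using finite_subset[OF Q] hollywood_flat_pairs_sets[OF X]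
    by (intro finite_measure_finite_Union) (auto simp: disjoint_family_on_def)
  also have "\<dots> = (\<Sum>ls\<in>Q. hw_prob a t ls)"
    using Q by (intro sum.cong refl hollywood_measure_eq[OF X] length_hw_support) auto
  finally show ?thesis .
qed

section \<open>Markov's inequality and Borel--Cantelli for functions of the label sequence\<close>

context hollywood_parameters
begin

lemma hollywood_Markov:
  assumes X: "hollywood_process M a t X" and r: "r > 0"
    and F: "\<And>ls. ls \<in> hw_support (2 * n) \<Longrightarrow> 0 \<le> F ls"
  shows "measure M {w\<in>space M. r \<le> F (flat_pairs (map (\<lambda>i. X i w) [0..<n]))}
    \<le> hw_mean a t (2 * n) F / r"
proof -
  interpret prob_space M using X by (simp add: hollywood_process_def)
  let ?L = "\<lambda>w. flat_pairs (map (\<lambda>i. X i w) [0..<n])"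
  let ?A = "{w\<in>space M. r \<le> F (?L w)}"
  let ?Q = "{ls\<in>hw_support (2 * n). r \<le> F ls}"
  have A: "?A \<in> sets M" by (rule hollywood_flat_pairs_sets[OF X])
  \<comment> \<open>\<open>F\<close> is controlled on the support only. Bounding the complement of
    the event from below by the support sequences with F < r, and using that the support has mass 1,
    shows that sequences outside it add nothing.\<close>
  have "(\<Sum>ls\<in>hw_support (2 * n) - ?Q. hw_prob a t ls) =
      measure M {w\<in>space M. ?L w \<in> hw_support (2 * n) - ?Q}"
    by (rule hollywood_measure_mem[OF X, symmetric]) auto
  also have "\<dots> \<le> measure M (space M - ?A)"
    using A by (intro finite_measure_mono) auto
  also have "\<dots> = 1 - measure M ?A" using A by (rule prob_compl)
  finally have "measure M ?A \<le> 1 - (\<Sum>ls\<in>hw_support (2 * n) - ?Q. hw_prob a t ls)" by simp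
  also have "(\<Sum>ls\<in>hw_support (2 * n) - ?Q. hw_prob a t ls) =
      (\<Sum>ls\<in>hw_support (2 * n). hw_prob a t ls) - (\<Sum>ls\<in>?Q. hw_prob a t ls)"
    by (rule sum_diff) auto
  also have "(\<Sum>ls\<in>hw_support (2 * n). hw_prob a t ls) = 1"
    using hw_mean_1[of "2 * n"] by (simp add: hw_mean_def)
  finally have "measure M ?A \<le> (\<Sum>ls\<in>?Q. hw_prob a t ls)" by simp
  also have "\<dots> \<le> (\<Sum>ls\<in>?Q. hw_prob a t ls * F ls / r)"
  proof (rule sum_mono)
    fix ls assume ls: "ls \<in> ?Q"
    then have "hw_prob a t ls * r \<le> hw_prob a t ls * F ls"
      using hw_prob_nonneg[of ls] by (intro mult_left_mono) auto
    then show "hw_prob a t ls \<le> hw_prob a t ls * F ls / r" using r by (simp add: le_divide_eq)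
  qed
  also have "\<dots> \<le> (\<Sum>ls\<in>hw_support (2 * n). hw_prob a t ls * F ls / r)"
    using r F hw_prob_nonneg by (intro sum_mono2) auto
  also have "\<dots> = hw_mean a t (2 * n) F / r"
    by (simp add: hw_mean_def sum_divide_distrib)
  finally show ?thesis .
qed

text \<open>At time 2^k Markov's inequality bounds the bad event by a constant times 2 to the power
  k(r - s), which is summable, so Borel--Cantelli applies.\<close>

lemma hollywood_eventually_less_powr:
  assumes X: "hollywood_process M a t X"
    and F: "\<And>n ls. ls \<in> hw_support n \<Longrightarrow> 0 \<le> F ls"
    and C: "\<And>n. n \<ge> 2 \<Longrightarrow> hw_mean a t n F \<le> C * real n powr r"
    and s: "r < s"
  shows "AE w in M. eventually (\<lambda>k. F (flat_pairs (map (\<lambda>i. X i w) [0..<2 ^ k]))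
    < real (2 ^ k) powr s) sequentially"
proof -
  interpret prob_space M using X by (simp add: hollywood_process_def)
  define A where "A k = {w\<in>space M. real (2 ^ k) powr s \<le>
    F (flat_pairs (map (\<lambda>i. X i w) [0..<2 ^ k]))}" for k :: nat
  have A: "A k \<in> sets M" for k
    unfolding A_def by (rule hollywood_flat_pairs_sets[OF X])
  have bound: "measure M (A k) \<le> C * 2 powr r * (2 powr (r - s)) ^ k" for k
  proof -
    \<comment> \<open>The first 2^k edges carry 2 * 2^k >= 2 labels, so the moment bound is
      available even for k = 0.\<close>
    have "measure M (A k) \<le> hw_mean a t (2 * 2 ^ k) F / real (2 ^ k) powr s"
      unfolding A_def using F by (intro hollywood_Markov[OF X]) auto
    also have "\<dots> \<le> C * real (2 * 2 ^ k) powr r / real (2 ^ k) powr s"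
      by (intro divide_right_mono C) auto
    also have "\<dots> = C * 2 powr r * (real (2 ^ k) powr r / real (2 ^ k) powr s)"
      by (simp add: powr_mult)
    also have "real (2 ^ k) powr r / real (2 ^ k) powr s = real (2 ^ k) powr (r - s)"
      by (rule powr_diff[symmetric])
    finally show ?thesis by (simp only: two_power_powr)
  qed
  have "2 powr (r - s) < (1::real)" using s by (simp add: powr_less_one)
  then have "summable (\<lambda>k. C * 2 powr r * (2 powr (r - s)) ^ k)"
    by (intro summable_mult summable_geometric) simp
  then have "summable (\<lambda>k. measure M (A k))"
    by (rule summable_comparison_test_ev[rotated]) (use bound in simp)
  then have "AE w in M. eventually (\<lambda>k. w \<in> space M - A k) sequentially"
    using A by (intro borel_cantelli_AE1) (auto simp: emeasure_eq_measure)
  then show ?thesis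
  proof (rule AE_mp, intro AE_I2 impI, elim eventually_mono)
    fix w k assume "w \<in> space M - A k"
    then show "F (flat_pairs (map (\<lambda>i. X i w) [0..<2 ^ k])) < real (2 ^ k) powr s"
      by (simp add: A_def not_le)
  qed
qed

lemma hollywood_few_high_degrees:
  assumes X: "hollywood_process M a t X" and p: "a < p" "p \<le> 1" and s: "p < s"
  shows "AE w in M. eventually (\<lambda>k. degree_sum p (flat_pairs (map (\<lambda>i. X i w) [0..<2 ^ k]))
    < real (2 ^ k) powr s) sequentially"
proof -
  obtain C where "\<And>n. n \<ge> 2 \<Longrightarrow> hw_mean a t n (degree_sum p) \<le> C * real n powr p"
    using hw_mean_degree_sum_bound[OF p] by blast
  moreover have "0 \<le> degree_sum p ls" for ls
    using card_le_degree_sum[of p ls] p a_pos by auto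
  ultimately show ?thesis using s by (intro hollywood_eventually_less_powr[OF X]) auto
qed

text \<open>The mean of the label weight decays with exponent -qa, so almost surely the weight is
  eventually below 2^k to the power -q(a - e). Comparing with c V^(-q) and taking q-th roots bounds
  V from below.\<close>

lemma hollywood_many_labels:
  assumes X: "hollywood_process M a t X" and e: "0 < e"
  shows "\<exists>c>0. AE w in M. eventually (\<lambda>k. c * real (2 ^ k) powr (a - e)
    \<le> real (card (set (flat_pairs (map (\<lambda>i. X i w) [0..<2 ^ k]))))) sequentially"
proof -
  obtain q where q: "0 < q" "q \<le> 1" "q < 1 + t / a"
  proof -
    have "0 < min 1 (1 + t / a)" using shifted_label_pos[of 1] by simp
    then obtain q where "0 < q" "q < min 1 (1 + t / a)" using dense by blast
    then show ?thesis by (intro that) auto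
  qed
  obtain C where C: "\<And>n. n \<ge> 2 \<Longrightarrow>
      hw_mean a t n (\<lambda>ls. label_weight q (card (set ls))) \<le> C * real n powr (- (q * a))"
    using hw_mean_label_weight_bound[OF q(1,3)] by blast
  obtain c where c: "c > 0" "\<And>V. V \<ge> 1 \<Longrightarrow> c * real V powr (- q) \<le> label_weight q V"
    using label_weight_lower[OF q] by blast
  define L where "L w k = set (flat_pairs (map (\<lambda>i. X i w) [0..<2 ^ k]))" for w and k :: nat
  have "AE w in M. eventually (\<lambda>k. label_weight q (card (L w k))
      < real (2 ^ k) powr (- (q * (a - e)))) sequentially"
    unfolding L_def
    using q e C label_weight_pos[OF q(1,3)]
    by (intro hollywood_eventually_less_powr[OF X]) (auto simp: less_imp_le algebra_simps)
  then have "AE w in M. eventually (\<lambda>k. c powr (1 / q) * real (2 ^ k) powr (a - e)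
      \<le> real (card (L w k))) sequentially"
  proof (rule AE_mp, intro AE_I2 impI, elim eventually_mono)
    fix w k
    assume less: "label_weight q (card (L w k)) < real (2 ^ k) powr (- (q * (a - e)))"
    define V where "V = card (L w k)"
    have "[0..<2 ^ k] \<noteq> ([] :: nat list)" by simp
    then have "L w k \<noteq> {}" by (simp add: L_def set_flat_pairs)
    then have V: "V \<ge> 1" by (simp add: V_def L_def Suc_le_eq card_gt_0_iff)
    define Z where "Z = real (2 ^ k) powr (q * (a - e))"
    have Z: "Z > 0" by (simp add: Z_def)
    have "c * real V powr (- q) \<le> real (2 ^ k) powr (- (q * (a - e)))"
      using c(2)[OF V] less unfolding V_def by linarith
    then have "c * inverse (real V powr q) \<le> inverse Z" by (simp only: powr_minus Z_def)
    then have "c * Z \<le> real V powr q"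
      using V Z by (simp add: field_simps)
    then have "c * real (2 ^ k) powr (q * (a - e)) \<le> real V powr q" by (simp only: Z_def)
    then have "(c * real (2 ^ k) powr (q * (a - e))) powr (1 / q) \<le> (real V powr q) powr (1 / q)"
      using q c(1) by (intro powr_mono2) auto
    then show "c powr (1 / q) * real (2 ^ k) powr (a - e) \<le> real (card (L w k))"
      using q c(1) V by (simp add: powr_mult powr_powr V_def)
  qed
  then show ?thesis
    unfolding L_def using c(1) by (intro exI[of _ "c powr (1 / q)"] conjI) auto
qed

end

section \<open>Sparsity\<close>

text \<open>The degree threshold is m to the power a/2. The first term counts edges with an end
  point of low degree, where \<open>degree_sum\<close> also bounds the number of labels; the second
  is the square of the number of labels of high degree.\<close>

lemma (in hollywood_parameters) dyadic_edge_bound: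
  fixes ps :: "(nat \<times> nat) list" and m s p :: real
  assumes p: "0 \<le> p" "p \<le> 1" and m: "m > 0"
    and S: "degree_sum p (flat_pairs ps) < m powr s"
  shows "real (card (set ps)) \<le> m powr (a / 2 + s) + m powr (2 * s - a * p)"
proof -
  define ls where "ls = flat_pairs ps"
  define d where "d = m powr (a / 2)"
  define B where "B = {i\<in>set ls. real (count_list ls i) > d}"
  have S': "degree_sum p ls \<le> m powr s" using S by (simp add: ls_def)
  have d: "d > 0" using m by (simp add: d_def)
  have "real (card B) * d powr p \<le> m powr s"
    unfolding B_def using high_degree_card_le[OF p, of d ls] d S' by simp
  then have B: "real (card B) \<le> m powr s / d powr p" using d by (simp add: le_divide_eq)
  have dp: "d powr p = m powr (a * p / 2)" by (simp add: d_def powr_powr)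
  have "real (card B) \<le> m powr (s - a * p / 2)" using B unfolding dp powr_diff .
  then have "real (card B) ^ 2 \<le> (m powr (s - a * p / 2)) ^ 2" by (intro power_mono) auto
  also have "\<dots> = m powr (2 * s - a * p)"
    by (simp add: power2_eq_square flip: powr_add)
  finally have B2: "real (card B) ^ 2 \<le> m powr (2 * s - a * p)" .
  have "d * real (card (set ls)) \<le> d * m powr s"
    using card_le_degree_sum[OF p, of ls] S' d by (intro mult_left_mono) auto
  also have "\<dots> = m powr (a / 2 + s)" by (simp add: d_def powr_add)
  finally show ?thesis
    using card_edges_le[of d ps] d B2 by (simp add: ls_def B_def)
qed

lemma floor_log_at_top: "filterlim floor_log at_top at_top"
  unfolding filterlim_at_top
proof
  fix k
  have "k \<le> floor_log n" if "n \<ge> 2 ^ k" for n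
    using floor_log_le_iff[OF that] by simp
  then show "eventually (\<lambda>n. k \<le> floor_log n) at_top"
    unfolding eventually_at_top_linorder by blast
qed

theorem theorem5p4:
  fixes M :: "'w measure" and X :: "nat \<Rightarrow> 'w \<Rightarrow> nat \<times> nat"
    and \<alpha> \<theta> c :: real
  assumes "0 < \<alpha>" and "\<alpha> < 1" and "\<theta> > - \<alpha>" and "c \<ge> 0"
    and "hollywood_process M \<alpha> \<theta> X"
  shows "AE w in M.
           limsup (\<lambda>n. ereal (real (card (hw_edges c (\<lambda>i. X i w) (Suc n)))
                               / real (card (hw_vertices (\<lambda>i. X i w) (Suc n))) ^ 2)) = 0"
proof -
  interpret hollywood_parameters \<alpha> \<theta> using assms by unfold_locales auto
  \<comment> \<open>The exponents below come to \<open>s1 = - \<alpha> / 2 + 4 * e\<close> and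
    \<open>s2 = 6 * e - \<alpha> * p\<close>. Both are negative since
    \<open>8 * e < \<alpha>\<^sup>2\<close>, while the factor \<open>1 - \<alpha>\<close> in
    \<open>e\<close> ensures p <= 1.\<close>
  define e where "e = \<alpha>\<^sup>2 * (1 - \<alpha>) / 8"
  define p where "p = \<alpha> + e"
  have a2: "0 < \<alpha>\<^sup>2" "\<alpha>\<^sup>2 < \<alpha>" using assms by (auto simp: power2_eq_square)
  have "\<alpha>\<^sup>2 * (1 - \<alpha>) < \<alpha>\<^sup>2 * 1" using a2 assms by (intro mult_strict_left_mono) auto
  then have e_lt: "8 * e < \<alpha>\<^sup>2" by (simp add: e_def)
  have "\<alpha>\<^sup>2 * (1 - \<alpha>) \<le> 1 * (1 - \<alpha>)" using a2 assms by (intro mult_right_mono) auto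
  then have e_le: "8 * e \<le> 1 - \<alpha>" by (simp add: e_def)
  have e: "0 < e" using a2 assms by (simp add: e_def)
  have p: "\<alpha> < p" "p \<le> 1" "0 \<le> p" using e e_le assms by (auto simp: p_def)
  define L where "L w n = map (\<lambda>i. X i w) [0..<n]" for w and n :: nat
  have L_mono: "set (L w i) \<subseteq> set (L w j)" if "i \<le> j" for w i j
    unfolding L_def set_map set_upt using that by (intro image_mono) auto
  obtain b where b: "b > 0" and labels: "AE w in M. eventually (\<lambda>k. b * real (2 ^ k) powr (\<alpha> - e)
      \<le> real (card (set (flat_pairs (L w (2 ^ k)))))) sequentially"
    unfolding L_def using hollywood_many_labels[OF assms(5) e] by blast
  have degrees: "AE w in M. eventually (\<lambda>k. degree_sum p (flat_pairs (L w (2 ^ k)))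
      < real (2 ^ k) powr (p + e)) sequentially"
    unfolding L_def using e by (intro hollywood_few_high_degrees[OF assms(5) p(1,2)]) simp
  define s1 where "s1 = \<alpha> / 2 + (p + e) - 2 * (\<alpha> - e)"
  define s2 where "s2 = 2 * (p + e) - \<alpha> * p - 2 * (\<alpha> - e)"
  have s1: "s1 < 0" using e_lt a2 by (simp add: s1_def p_def)
  have "\<alpha> * p > \<alpha>\<^sup>2" using p assms by (simp add: power2_eq_square)
  then have s2: "s2 < 0" using e_lt e by (simp add: s2_def p_def)
  define K where "K = 2 powr (2 * (\<alpha> - e)) / b\<^sup>2"
  \<comment> \<open>Edges are taken at the next power of two and vertices at the present one, so by
    monotonicity \<open>R w k\<close> dominates the ratio at all times in between.\<close>
  define R where "R w k = real (card (set (L w (2 ^ Suc k))))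
    / real (card (set (flat_pairs (L w (2 ^ k))))) ^ 2" for w and k :: nat
  from labels degrees show ?thesis
  proof eventually_elim
    case (elim w)
    have ev: "eventually (\<lambda>k. degree_sum p (flat_pairs (L w (2 ^ Suc k)))
        < real (2 ^ Suc k) powr (p + e)) sequentially"
      using elim(2) by (subst eventually_sequentially_Suc)
    have R_le: "eventually (\<lambda>k. R w k \<le>
        K * (real (2 ^ Suc k) powr s1 + real (2 ^ Suc k) powr s2)) sequentially"
      using elim(1) ev
    proof eventually_elim
      case (elim k)
      define m where "m = real (2 ^ Suc k)"
      have m: "m > 0" by (simp add: m_def)
      \<comment> \<open>With m = 2^(k+1), the vertices are counted at time m/2; this halving
        produces the power of 2 in \<open>K\<close>.\<close>
      define D where "D = b * (m / 2) powr (\<alpha> - e)"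
      have D: "D > 0" using b m by (simp add: D_def)
      have "((m / 2) powr (\<alpha> - e))\<^sup>2 = (m / 2) powr (2 * (\<alpha> - e))"
        unfolding power2_eq_square powr_add[symmetric] mult_2 ..
      also have "\<dots> = m powr (2 * (\<alpha> - e)) / 2 powr (2 * (\<alpha> - e))"
        by (rule powr_divide)
      finally have D2: "D\<^sup>2 = m powr (2 * (\<alpha> - e)) / K"
        unfolding D_def K_def power_mult_distrib using b by (simp add: field_simps)
      have "D \<le> real (card (set (flat_pairs (L w (2 ^ k)))))"
        using elim(1) by (simp add: D_def m_def)
      then have "R w k \<le> (m powr (\<alpha> / 2 + (p + e)) + m powr (2 * (p + e) - \<alpha> * p)) / D\<^sup>2"
        unfolding R_def
        using dyadic_edge_bound[OF p(3,2) m elim(2)[folded m_def]] D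
        by (intro frac_le power_mono) auto
      also have "\<dots> = K * (m powr s1 + m powr s2)"
        unfolding D2 s1_def s2_def powr_diff[of _ _ "2 * (\<alpha> - e)"]
        by (simp add: distrib_left add_divide_distrib mult.commute)
      finally show ?case by (simp add: m_def)
    qed
    have lim: "(\<lambda>k. K * (real (2 ^ Suc k) powr s1 + real (2 ^ Suc k) powr s2)) \<longlonglongrightarrow> K * (0 + 0)"
      using LIMSEQ_Suc[OF two_power_powr_tendsto_0[OF s1]] LIMSEQ_Suc[OF two_power_powr_tendsto_0[OF s2]]
      by (intro tendsto_intros)
    have "R w \<longlonglongrightarrow> 0"
    proof (rule tendsto_sandwich)
      show "eventually (\<lambda>k. 0 \<le> R w k) sequentially" by (simp add: R_def)
    qed (use R_le lim in auto)
    moreover have "filterlim (\<lambda>n. floor_log (Suc n)) at_top sequentially"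
      using filterlim_compose[OF floor_log_at_top filterlim_Suc] .
    ultimately have R_lim: "(\<lambda>n. R w (floor_log (Suc n))) \<longlonglongrightarrow> 0" by (rule filterlim_compose)
    let ?r = "\<lambda>n. real (card (hw_edges c (\<lambda>i. X i w) (Suc n)))
      / real (card (hw_vertices (\<lambda>i. X i w) (Suc n))) ^ 2"
    have le: "?r n \<le> R w (floor_log (Suc n))" for n
      unfolding R_def
    proof (intro frac_le power_mono)
      let ?k = "floor_log (Suc n)"
      have up: "Suc n \<le> 2 ^ Suc ?k" using floor_log_exp2_ge[of "Suc n"] by simp
      have lo: "2 ^ ?k \<le> Suc n" by (rule floor_log_exp2_le) simp
      have "hw_edges c (\<lambda>i. X i w) (Suc n) \<subseteq> set (L w (Suc n))"
        unfolding L_def by (rule hw_edges_subset[OF assms(4)])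
      also have "\<dots> \<subseteq> set (L w (2 ^ Suc ?k))" using up by (rule L_mono)
      finally show "real (card (hw_edges c (\<lambda>i. X i w) (Suc n))) \<le> real (card (set (L w (2 ^ Suc ?k))))"
        by (simp add: card_mono)
      have "set (L w (2 ^ ?k)) \<subseteq> set (L w (Suc n))" using lo by (rule L_mono)
      then have "set (flat_pairs (L w (2 ^ ?k))) \<subseteq> hw_vertices (\<lambda>i. X i w) (Suc n)"
        unfolding hw_vertices_eq L_def[symmetric] set_flat_pairs by blast
      then show "real (card (set (flat_pairs (L w (2 ^ ?k))))) \<le> real (card (hw_vertices (\<lambda>i. X i w) (Suc n)))"
        by (simp add: card_mono hw_vertices_eq)
      show "0 < real (card (set (flat_pairs (L w (2 ^ ?k))))) ^ 2"
        by (simp add: L_def set_flat_pairs card_gt_0_iff)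
    qed simp_all
    have "?r \<longlonglongrightarrow> 0"
    proof (rule tendsto_sandwich[OF _ _ tendsto_const R_lim])
      show "eventually (\<lambda>n. ?r n \<le> R w (floor_log (Suc n))) sequentially"
        using le by (intro always_eventually allI)
    qed simp
    then have "(\<lambda>n. ereal (?r n)) \<longlonglongrightarrow> ereal 0" by (rule tendsto_ereal)
    then have "(\<lambda>n. ereal (?r n)) \<longlonglongrightarrow> 0" by (simp only: zero_ereal_def)
    then show ?case by (intro lim_imp_Limsup) auto
  qed
qed

end
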